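(* Let $(\Omega,\Gamma,\ell)$ be a perfectly mixable game of prediction, with $\Gamma$ a subset of a Euclidean space whose norm is denoted $|\cdot|$. Suppose that, in the competitive prediction protocol for this game, Sceptic has a strategy that guarantees $$\lim_{N\to\infty}\max\left(\frac{1}{\left|\gamma^{[1]}_N-\gamma^{[2]}_N\right|},\;L^{[1]}_N-\tilde L_N,\;L^{[2]}_N-\tilde L_N\right)=\infty .$$ Then Sceptic also has a strategy in the competitive prediction protocol for this game that guarantees $$\lim_{N\to\infty}\left|\gamma^{[1]}_N-\gamma^{[2]}_N\right|=0\quad\text{or}\quad\lim_{N\to\infty}\left(L^{[1]}_N-\tilde L_N\right)=\infty\quad\text{or}\quad\lim_{N\to\infty}\left(L^{[2]}_N-\tilde L_N\right)=\infty$$ (and, a fortiori, that guarantees $\lim_{N\to\infty}|\gamma^{[1]}_N-\gamma^{[2]}_N|=0$ or $\lim_{N\to\infty}\max(L^{[1]}_N-\tilde L_N,\,L^{[2]}_N-\tilde L_N)=\infty$).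
   Context: A game of prediction is a triple $(\Omega,\Gamma,\ell)$ where $\Omega$ (outcome space) and $\Gamma$ (prediction space) are sets and $\ell:\Omega\times\Gamma\to\mathbb{R}$ is the loss function. Competitive prediction protocol (perfect information; players: Nature, Predictor 1, Predictor 2, Sceptic): at each step $n=1,2,\ldots$, first Predictor 1 and Predictor 2 announce $\gamma_n^{[1]}\in\Gamma$ and $\gamma_n^{[2]}\in\Gamma$; then Sceptic announces $\tilde\gamma_n\in\Gamma$; then Nature announces $\omega_n\in\Omega$. A strategy for Sceptic is a function determining $\tilde\gamma_n$ from all moves made before it (the outcomes and all predictions of the steps before $n$, together with $\gamma_n^{[1]},\gamma_n^{[2]}$). It guarantees a property if the property holds for all sequences of moves of the other players when Sceptic follows it. Cumulative losses: $L_N^{[k]}=\sum_{n=1}^N\ell(\omega_n,\gamma_n^{[k]})$ for $k=1,2$, and $\tilde L_N=\sum_{n=1}^N\ell(\omega_n,\tilde\gamma_n)$. Convention: $1/0:=\infty$. A canonical prediction is a function $\lambda:\Omega\to\mathbb{R}$ of the form $\lambda(\omega)=\ell(\omega,\gamma)$ for all $\omega\in\Omega$, for some $\gamma\in\Gamma$. A superprediction is a function $\lambda:\Omega\to\mathbb{R}$ such that $\lambda\ge\lambda'$ pointwise for some canonical prediction $\lambda'$; the set of all superpredictions is denoted $\overline{\Lambda}$. The game is perfectly mixable if, for some $\eta>0$, the set $e^{-\eta\overline{\Lambda}}=\{e^{-\eta\lambda}:\lambda\in\overline{\Lambda}\}$ (of functions on $\Omega$) is convex. *)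

theory Defs
  imports "HOL-Analysis.Analysis"
begin

text \<open>
  A game of prediction is given by an outcome space \<open>\<Omega>\<close>, a prediction space \<open>\<Gamma>\<close> and a loss
  function \<open>loss\<close>, whose values matter only on \<open>\<Omega> \<times> \<Gamma>\<close>. Functions on \<open>\<Omega>\<close> are represented by
  the extensional functions on \<open>\<Omega>\<close>.
\<close>

definition canonical_predictions ::
    "'w set \<Rightarrow> 'a set \<Rightarrow> ('w \<Rightarrow> 'a \<Rightarrow> real) \<Rightarrow> ('w \<Rightarrow> real) set" where
  "canonical_predictions \<Omega> \<Gamma> loss =
    {l \<in> \<Omega> \<rightarrow>\<^sub>E UNIV. \<exists>\<gamma>\<in>\<Gamma>. \<forall>\<omega>\<in>\<Omega>. l \<omega> = loss \<omega> \<gamma>}"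

definition superpredictions ::
    "'w set \<Rightarrow> 'a set \<Rightarrow> ('w \<Rightarrow> 'a \<Rightarrow> real) \<Rightarrow> ('w \<Rightarrow> real) set" where
  "superpredictions \<Omega> \<Gamma> loss =
    {l \<in> \<Omega> \<rightarrow>\<^sub>E UNIV. \<exists>l'\<in>canonical_predictions \<Omega> \<Gamma> loss. \<forall>\<omega>\<in>\<Omega>. l \<omega> \<ge> l' \<omega>}"

definition exp_superpredictions ::
    "'w set \<Rightarrow> 'a set \<Rightarrow> ('w \<Rightarrow> 'a \<Rightarrow> real) \<Rightarrow> real \<Rightarrow> ('w \<Rightarrow> real) set" where
  "exp_superpredictions \<Omega> \<Gamma> loss \<eta> =
    (\<lambda>l. \<lambda>\<omega>\<in>\<Omega>. exp (- \<eta> * l \<omega>)) ` superpredictions \<Omega> \<Gamma> loss"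

text \<open>
  The function type is not an instance of \<^class>\<open>real_vector\<close>, so the definition of
  \<^const>\<open>convex\<close> is repeated here with the pointwise operations of functions on \<open>\<Omega>\<close>.
\<close>

definition convex_functions :: "'w set \<Rightarrow> ('w \<Rightarrow> real) set \<Rightarrow> bool" where
  "convex_functions \<Omega> S \<longleftrightarrow>
    (\<forall>f\<in>S. \<forall>g\<in>S. \<forall>u\<ge>0. \<forall>v\<ge>0. u + v = 1 \<longrightarrow> (\<lambda>\<omega>\<in>\<Omega>. u * f \<omega> + v * g \<omega>) \<in> S)"

definition perfectly_mixable ::
    "'w set \<Rightarrow> 'a set \<Rightarrow> ('w \<Rightarrow> 'a \<Rightarrow> real) \<Rightarrow> bool" where
  "perfectly_mixable \<Omega> \<Gamma> loss \<longleftrightarrow>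
    (\<exists>\<eta>>0. convex_functions \<Omega> (exp_superpredictions \<Omega> \<Gamma> loss \<eta>))"

text \<open>
  A round lists the moves of Predictor 1, Predictor 2, Sceptic and Nature, in this order.
  A strategy for Sceptic maps the list of all earlier rounds (oldest first) and the current
  moves of the two Predictors to a prediction. Rounds of a play are numbered from 1; the
  entries at index 0 of the sequences of moves are irrelevant.
\<close>

type_synonym ('w, 'a) round = "'a \<times> 'a \<times> 'a \<times> 'w"

type_synonym ('w, 'a) strategy = "('w, 'a) round list \<Rightarrow> 'a \<Rightarrow> 'a \<Rightarrow> 'a"

definition sceptic_strategy :: "'w set \<Rightarrow> 'a set \<Rightarrow> ('w, 'a) strategy \<Rightarrow> bool" where
  "sceptic_strategy \<Omega> \<Gamma> \<sigma> \<longleftrightarrow>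
    (\<forall>h\<in>lists (\<Gamma> \<times> \<Gamma> \<times> \<Gamma> \<times> \<Omega>). \<forall>\<gamma>1\<in>\<Gamma>. \<forall>\<gamma>2\<in>\<Gamma>. \<sigma> h \<gamma>1 \<gamma>2 \<in> \<Gamma>)"

definition history ::
    "(nat \<Rightarrow> 'a) \<Rightarrow> (nat \<Rightarrow> 'a) \<Rightarrow> (nat \<Rightarrow> 'a) \<Rightarrow> (nat \<Rightarrow> 'w) \<Rightarrow> nat \<Rightarrow> ('w, 'a) round list" where
  "history \<gamma>1 \<gamma>2 \<gamma>s \<omega> n = map (\<lambda>i. (\<gamma>1 i, \<gamma>2 i, \<gamma>s i, \<omega> i)) [1..<n]"

definition follows ::
    "('w, 'a) strategy \<Rightarrow> (nat \<Rightarrow> 'a) \<Rightarrow> (nat \<Rightarrow> 'a) \<Rightarrow> (nat \<Rightarrow> 'a) \<Rightarrow> (nat \<Rightarrow> 'w) \<Rightarrow> bool" where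
  "follows \<sigma> \<gamma>1 \<gamma>2 \<gamma>s \<omega> \<longleftrightarrow>
    (\<forall>n\<ge>1. \<gamma>s n = \<sigma> (history \<gamma>1 \<gamma>2 \<gamma>s \<omega> n) (\<gamma>1 n) (\<gamma>2 n))"

definition guarantees ::
    "'w set \<Rightarrow> 'a set \<Rightarrow> ('w, 'a) strategy \<Rightarrow>
      ((nat \<Rightarrow> 'a) \<Rightarrow> (nat \<Rightarrow> 'a) \<Rightarrow> (nat \<Rightarrow> 'a) \<Rightarrow> (nat \<Rightarrow> 'w) \<Rightarrow> bool) \<Rightarrow> bool" where
  "guarantees \<Omega> \<Gamma> \<sigma> P \<longleftrightarrow>
    (\<forall>\<gamma>1 \<gamma>2 \<gamma>s \<omega>. (\<forall>n\<ge>1. \<gamma>1 n \<in> \<Gamma> \<and> \<gamma>2 n \<in> \<Gamma> \<and> \<omega> n \<in> \<Omega>) \<longrightarrow>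
      follows \<sigma> \<gamma>1 \<gamma>2 \<gamma>s \<omega> \<longrightarrow> P \<gamma>1 \<gamma>2 \<gamma>s \<omega>)"

definition cumulative_loss ::
    "('w \<Rightarrow> 'a \<Rightarrow> real) \<Rightarrow> (nat \<Rightarrow> 'w) \<Rightarrow> (nat \<Rightarrow> 'a) \<Rightarrow> nat \<Rightarrow> real" where
  "cumulative_loss loss \<omega> \<gamma> N = (\<Sum>n=1..N. loss (\<omega> n) (\<gamma> n))"

end

theory Submission
  imports Defs
begin

text \<open>
  Sceptic simulates the given strategy and mixes its predictions with those of the two Predictors.
  If \<open>\<Lambda>\<close> is the loss of the simulated strategy, he maintains
  \<open>exp (- \<eta> * L~) \<ge> exp (- \<eta> * \<Lambda>) / 2 ^ (j + k) + j * exp (- \<eta> * L1) + k * exp (- \<eta> * L2)\<close>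
  for two counters \<open>j\<close> and \<open>k\<close>: convexity preserves the inequality during a round. Whenever
  \<open>exp (\<eta> * (L1 - \<Lambda>)) \<ge> 2 ^ (j + k + 1)\<close>, half of the first summand pays for an increment of \<open>j\<close>,
  and similarly for \<open>k\<close>. If a counter grows without bound, the advantage of Sceptic over the
  corresponding Predictor tends to infinity. If both stay bounded, so do \<open>L1 - \<Lambda>\<close> and \<open>L2 - \<Lambda>\<close>
  from above, and then the hypothesis makes the distance between the Predictors tend to 0.
\<close>

section \<open>Mixtures of predictions in a perfectly mixable game\<close>

text \<open>Convexity with the normalized weights \<open>a / (a + b)\<close> and
  \<open>b / (a + b)\<close> yields a superprediction \<open>l\<close>. Any \<open>z\<close> whose
  canonical prediction lies below \<open>l\<close> works, because \<open>exp (- \<eta> * _)\<close>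
  is decreasing. One of the weights may vanish.\<close>

lemma mixture_of_two:
  assumes convex: "convex_functions \<Omega> (exp_superpredictions \<Omega> \<Gamma> loss \<eta>)" and "\<eta> > 0"
    and "x \<in> \<Gamma>" "y \<in> \<Gamma>" and ab: "a \<ge> 0" "b \<ge> 0" "a + b > 0"
  shows "\<exists>z\<in>\<Gamma>. \<forall>\<omega>\<in>\<Omega>.
    a * exp (- \<eta> * loss \<omega> x) + b * exp (- \<eta> * loss \<omega> y) \<le> (a + b) * exp (- \<eta> * loss \<omega> z)"
proof -
  let ?E = "exp_superpredictions \<Omega> \<Gamma> loss \<eta>"
  let ?e = "\<lambda>x. \<lambda>\<omega>\<in>\<Omega>. exp (- \<eta> * loss \<omega> x)"
  have mem: "?e x \<in> ?E" if "x \<in> \<Gamma>" for x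
    unfolding exp_superpredictions_def superpredictions_def canonical_predictions_def
    by (rule image_eqI[where x = "\<lambda>\<omega>\<in>\<Omega>. loss \<omega> x"]) (use that in \<open>auto intro!: restrict_ext exI[of _ "\<lambda>\<omega>\<in>\<Omega>. loss \<omega> x"]\<close>)
  have "a / (a + b) + b / (a + b) = 1"
    using ab by (simp add: add_divide_distrib[symmetric])
  then have "(\<lambda>\<omega>\<in>\<Omega>. a / (a + b) * ?e x \<omega> + b / (a + b) * ?e y \<omega>) \<in> ?E"
    by (intro convex[unfolded convex_functions_def, rule_format])
      (use mem \<open>x \<in> \<Gamma>\<close> \<open>y \<in> \<Gamma>\<close> ab in \<open>simp_all del: restrict_apply\<close>)
  then obtain l where "l \<in> superpredictions \<Omega> \<Gamma> loss"
    and eq: "(\<lambda>\<omega>\<in>\<Omega>. a / (a + b) * ?e x \<omega> + b / (a + b) * ?e y \<omega>) = (\<lambda>\<omega>\<in>\<Omega>. exp (- \<eta> * l \<omega>))"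
    unfolding exp_superpredictions_def by blast
  then obtain z where "z \<in> \<Gamma>" and l: "\<And>\<omega>. \<omega> \<in> \<Omega> \<Longrightarrow> loss \<omega> z \<le> l \<omega>"
    unfolding superpredictions_def canonical_predictions_def by auto
  have "a * exp (- \<eta> * loss \<omega> x) + b * exp (- \<eta> * loss \<omega> y) \<le> (a + b) * exp (- \<eta> * loss \<omega> z)"
    if "\<omega> \<in> \<Omega>" for \<omega>
  proof -
    have "a / (a + b) * exp (- \<eta> * loss \<omega> x) + b / (a + b) * exp (- \<eta> * loss \<omega> y) = exp (- \<eta> * l \<omega>)"
      using fun_cong[OF eq, of \<omega>] that by simp
    also have "\<dots> \<le> exp (- \<eta> * loss \<omega> z)"
      using l[OF that] \<open>\<eta> > 0\<close> by simp
    finally show ?thesis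
      using ab by (simp add: divide_simps mult.commute split: if_splits)
  qed
  with \<open>z \<in> \<Gamma>\<close> show ?thesis by blast
qed

text \<open>Mix twice: \<open>x\<close> and \<open>y\<close> are merged into \<open>u\<close> of
  weight \<open>a + b\<close>, and then \<open>u\<close> is mixed with \<open>t\<close>. Positivity
  of \<open>a\<close> keeps both total weights positive even when \<open>b\<close> and
  \<open>c\<close>, which carry the counters, are 0.\<close>

lemma mixture_of_three:
  assumes convex: "convex_functions \<Omega> (exp_superpredictions \<Omega> \<Gamma> loss \<eta>)" and "\<eta> > 0"
    and "x \<in> \<Gamma>" "y \<in> \<Gamma>" "t \<in> \<Gamma>" and abc: "a > 0" "b \<ge> 0" "c \<ge> 0"
  shows "\<exists>z\<in>\<Gamma>. \<forall>\<omega>\<in>\<Omega>.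
    a * exp (- \<eta> * loss \<omega> x) + b * exp (- \<eta> * loss \<omega> y) + c * exp (- \<eta> * loss \<omega> t)
      \<le> (a + b + c) * exp (- \<eta> * loss \<omega> z)"
proof -
  obtain u where u: "u \<in> \<Gamma>" "\<And>\<omega>. \<omega> \<in> \<Omega> \<Longrightarrow>
      a * exp (- \<eta> * loss \<omega> x) + b * exp (- \<eta> * loss \<omega> y) \<le> (a + b) * exp (- \<eta> * loss \<omega> u)"
    using mixture_of_two[OF convex \<open>\<eta> > 0\<close> \<open>x \<in> \<Gamma>\<close> \<open>y \<in> \<Gamma>\<close>, of a b] abc by auto
  obtain z where "z \<in> \<Gamma>" "\<And>\<omega>. \<omega> \<in> \<Omega> \<Longrightarrow>
      (a + b) * exp (- \<eta> * loss \<omega> u) + c * exp (- \<eta> * loss \<omega> t) \<le> (a + b + c) * exp (- \<eta> * loss \<omega> z)"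
    using mixture_of_two[OF convex \<open>\<eta> > 0\<close> u(1) \<open>t \<in> \<Gamma>\<close>, of "a + b" c] abc by auto
  with u(2) show ?thesis
    by (intro bexI[of _ z]) (auto intro: order_trans[OF add_right_mono])
qed

section \<open>Simulation of the given strategy, and the mixing strategy\<close>

text \<open>The state and the weights evaluate this on simulated histories, whose third entries are
  moves of \<open>\<sigma>\<close>. There it is L1 - \<Lambda>, not the advantage of the actual
  Sceptic.\<close>

definition advantage1 :: "('w \<Rightarrow> 'a \<Rightarrow> real) \<Rightarrow> ('w, 'a) round list \<Rightarrow> real" where
  "advantage1 loss h = sum_list (map (\<lambda>(x, y, s, \<omega>). loss \<omega> x - loss \<omega> s) h)"

definition advantage2 :: "('w \<Rightarrow> 'a \<Rightarrow> real) \<Rightarrow> ('w, 'a) round list \<Rightarrow> real" where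
  "advantage2 loss h = sum_list (map (\<lambda>(x, y, s, \<omega>). loss \<omega> y - loss \<omega> s) h)"

text \<open>A state is the simulated history of \<open>\<sigma>\<close>, with the moves of \<open>\<sigma>\<close> in place of the actual
  moves of Sceptic, and the two counters.\<close>

fun update_state :: "real \<Rightarrow> ('w \<Rightarrow> 'a \<Rightarrow> real) \<Rightarrow> ('w, 'a) strategy \<Rightarrow>
    ('w, 'a) round list \<times> nat \<times> nat \<Rightarrow> ('w, 'a) round \<Rightarrow> ('w, 'a) round list \<times> nat \<times> nat" where
  "update_state \<eta> loss \<sigma> (h, j, k) (x, y, _, \<omega>) =
    (let h' = h @ [(x, y, \<sigma> h x y, \<omega>)] in
      if 2 ^ Suc (j + k) \<le> exp (\<eta> * advantage1 loss h') then (h', Suc j, k)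
      else if 2 ^ Suc (j + k) \<le> exp (\<eta> * advantage2 loss h') then (h', j, Suc k)
      else (h', j, k))"

definition state :: "real \<Rightarrow> ('w \<Rightarrow> 'a \<Rightarrow> real) \<Rightarrow> ('w, 'a) strategy \<Rightarrow>
    ('w, 'a) round list \<Rightarrow> ('w, 'a) round list \<times> nat \<times> nat" where
  "state \<eta> loss \<sigma> = foldl (update_state \<eta> loss \<sigma>) ([], 0, 0)"

text \<open>\<open>a\<close>, \<open>b\<close> and \<open>c\<close> are the summands on the right of the invariant, multiplied by \<open>exp (\<eta> * \<Lambda>)\<close>.\<close>

definition mixes :: "'w set \<Rightarrow> 'a set \<Rightarrow> real \<Rightarrow> ('w \<Rightarrow> 'a \<Rightarrow> real) \<Rightarrow> ('w, 'a) strategy \<Rightarrow>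
    ('w, 'a) round list \<times> nat \<times> nat \<Rightarrow> 'a \<Rightarrow> 'a \<Rightarrow> 'a \<Rightarrow> bool" where
  "mixes \<Omega> \<Gamma> \<eta> loss \<sigma> = (\<lambda>(h, j, k) x y z. z \<in> \<Gamma> \<and>
    (let a = 1 / 2 ^ (j + k);
         b = j * exp (- \<eta> * advantage1 loss h);
         c = k * exp (- \<eta> * advantage2 loss h)
     in \<forall>\<omega>\<in>\<Omega>. a * exp (- \<eta> * loss \<omega> (\<sigma> h x y)) + b * exp (- \<eta> * loss \<omega> x) + c * exp (- \<eta> * loss \<omega> y)
          \<le> (a + b + c) * exp (- \<eta> * loss \<omega> z)))"

text \<open>The state is recomputed from the actual history, so the move depends only on what
  Sceptic has seen. On legal histories and moves the choice has a witness, by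
  \<open>mixing_strategy_mixes\<close>.\<close>

definition mixing_strategy :: "'w set \<Rightarrow> 'a set \<Rightarrow> real \<Rightarrow> ('w \<Rightarrow> 'a \<Rightarrow> real) \<Rightarrow>
    ('w, 'a) strategy \<Rightarrow> ('w, 'a) strategy" where
  "mixing_strategy \<Omega> \<Gamma> \<eta> loss \<sigma> h x y = (SOME z. mixes \<Omega> \<Gamma> \<eta> loss \<sigma> (state \<eta> loss \<sigma> h) x y z)"

lemma mixes_in_predictions: "mixes \<Omega> \<Gamma> \<eta> loss \<sigma> S x y z \<Longrightarrow> z \<in> \<Gamma>"
  by (cases S) (simp add: mixes_def)

text \<open>The legality of the moves of \<open>\<sigma>\<close> is known only on legal histories,
  so it has to be propagated through the simulation round by round.\<close>

lemma simulated_history_in_lists: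
  assumes "sceptic_strategy \<Omega> \<Gamma> \<sigma>" and "h \<in> lists (\<Gamma> \<times> \<Gamma> \<times> \<Gamma> \<times> \<Omega>)"
  shows "fst (state \<eta> loss \<sigma> h) \<in> lists (\<Gamma> \<times> \<Gamma> \<times> \<Gamma> \<times> \<Omega>)"
  using assms(2)
proof (induction h rule: rev_induct)
  case Nil
  then show ?case by (simp add: state_def)
next
  case (snoc r h)
  obtain h' j k where st: "state \<eta> loss \<sigma> h = (h', j, k)"
    by (metis prod_cases3)
  obtain x y s \<omega> where r: "r = (x, y, s, \<omega>)"
    by (metis prod_cases4)
  have "h' \<in> lists (\<Gamma> \<times> \<Gamma> \<times> \<Gamma> \<times> \<Omega>)" "x \<in> \<Gamma>" "y \<in> \<Gamma>" "\<omega> \<in> \<Omega>"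
    using snoc st r by auto
  moreover from this have "\<sigma> h' x y \<in> \<Gamma>"
    using assms(1) by (auto simp: sceptic_strategy_def)
  ultimately show ?case
    using st r by (auto simp: state_def Let_def)
qed

text \<open>The weight \<open>1 / 2 ^ (j + k)\<close> of the simulated move never vanishes, so the
  mixture of three predictions exists in every round.\<close>

lemma mixing_strategy_mixes:
  assumes "convex_functions \<Omega> (exp_superpredictions \<Omega> \<Gamma> loss \<eta>)" and "\<eta> > 0"
    and "sceptic_strategy \<Omega> \<Gamma> \<sigma>" and "h \<in> lists (\<Gamma> \<times> \<Gamma> \<times> \<Gamma> \<times> \<Omega>)" and "x \<in> \<Gamma>" "y \<in> \<Gamma>"
  shows "mixes \<Omega> \<Gamma> \<eta> loss \<sigma> (state \<eta> loss \<sigma> h) x y (mixing_strategy \<Omega> \<Gamma> \<eta> loss \<sigma> h x y)"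
proof -
  obtain h' j k where st: "state \<eta> loss \<sigma> h = (h', j, k)"
    by (metis prod_cases3)
  have "\<sigma> h' x y \<in> \<Gamma>"
    using simulated_history_in_lists[OF assms(3,4), of \<eta> loss] assms(3,5,6) st
    by (simp add: sceptic_strategy_def)
  from mixture_of_three[OF assms(1,2) this assms(5,6), of "1 / 2 ^ (j + k)"
      "j * exp (- \<eta> * advantage1 loss h')" "k * exp (- \<eta> * advantage2 loss h')"]
  have "\<exists>z. mixes \<Omega> \<Gamma> \<eta> loss \<sigma> (state \<eta> loss \<sigma> h) x y z"
    by (auto simp: st mixes_def Let_def)
  then show ?thesis
    unfolding mixing_strategy_def by (rule someI_ex)
qed

section \<open>Histories and losses along a play\<close>

lemma history_Suc:
  assumes "n \<ge> 1"
  shows "history x y s \<omega> (Suc n) = history x y s \<omega> n @ [(x n, y n, s n, \<omega> n)]"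
  using assms by (simp add: history_def)

lemma history_1: "history x y s \<omega> (Suc 0) = []"
  by (simp add: history_def)

lemma history_in_lists:
  assumes "\<And>i. \<lbrakk>1 \<le> i; i < n\<rbrakk> \<Longrightarrow> x i \<in> \<Gamma> \<and> y i \<in> \<Gamma> \<and> s i \<in> \<Gamma> \<and> \<omega> i \<in> \<Omega>"
  shows "history x y s \<omega> n \<in> lists (\<Gamma> \<times> \<Gamma> \<times> \<Gamma> \<times> \<Omega>)"
  using assms by (auto simp: history_def)

text \<open>The history at index \<open>Suc n\<close> consists of the rounds 1 to \<open>n\<close>,
  which is why it matches the cumulative losses at \<open>n\<close>.\<close>

lemma advantage_history:
  "advantage1 loss (history x y s \<omega> (Suc n)) = cumulative_loss loss \<omega> x n - cumulative_loss loss \<omega> s n"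
  "advantage2 loss (history x y s \<omega> (Suc n)) = cumulative_loss loss \<omega> y n - cumulative_loss loss \<omega> s n"
  by (induction n)
    (simp_all add: history_1 history_Suc advantage1_def advantage2_def cumulative_loss_def)

text \<open>Strong induction is needed: the move in round \<open>n\<close> is legal because the
  whole history before it is.\<close>

lemma follows_in_predictions:
  assumes \<sigma>: "sceptic_strategy \<Omega> \<Gamma> \<sigma>" and "follows \<sigma> x y s \<omega>"
    and moves: "\<And>n. n \<ge> 1 \<Longrightarrow> x n \<in> \<Gamma> \<and> y n \<in> \<Gamma> \<and> \<omega> n \<in> \<Omega>"
  shows "n \<ge> 1 \<Longrightarrow> s n \<in> \<Gamma>"
proof (induction n rule: less_induct)
  case (less n)
  have "history x y s \<omega> n \<in> lists (\<Gamma> \<times> \<Gamma> \<times> \<Gamma> \<times> \<Omega>)"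
    by (rule history_in_lists) (use less.IH moves in auto)
  then show ?case
    using assms less.prems by (simp add: follows_def sceptic_strategy_def)
qed

section \<open>Asymptotics of the two counters\<close>

text \<open>The analytic core, free of the game: \<open>D1\<close> and \<open>D2\<close> stand for
  the advantages of the simulated strategy, \<open>E1\<close> and \<open>E2\<close> for those of the
  actual Sceptic, and \<open>d\<close> for the distance between the Predictors.\<close>

lemma counters_dichotomy:
  fixes j k :: "nat \<Rightarrow> nat" and d D1 D2 E1 E2 :: "nat \<Rightarrow> real"
  assumes "\<eta> > 0"
    and step: "\<And>N. (j (Suc N), k (Suc N)) =
      (if 2 ^ Suc (j N + k N) \<le> exp (\<eta> * D1 (Suc N)) then (Suc (j N), k N)
       else if 2 ^ Suc (j N + k N) \<le> exp (\<eta> * D2 (Suc N)) then (j N, Suc (k N))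
       else (j N, k N))"
    and E1: "\<And>N. real (j N) \<le> exp (\<eta> * E1 N)" and E2: "\<And>N. real (k N) \<le> exp (\<eta> * E2 N)"
    and d: "\<And>N. d N \<ge> 0"
    and lim: "(\<lambda>N. max (1 / ereal (d N)) (max (ereal (D1 N)) (ereal (D2 N)))) \<longlonglongrightarrow> \<infinity>"
  shows "d \<longlonglongrightarrow> 0 \<or> filterlim E1 at_top sequentially \<or> filterlim E2 at_top sequentially"
proof -
  have mono: "mono j" "mono k"
  proof -
    have "j N \<le> j (Suc N) \<and> k N \<le> k (Suc N)" for N
      using step[of N] by (simp split: if_splits)
    then show "mono j" "mono k"
      by (simp_all add: mono_iff_le_Suc)
  qed
  have unbounded: "filterlim E at_top sequentially"
    if "mono i" and no_bound: "\<nexists>C. \<forall>N. i N \<le> C" and E: "\<And>N. real (i N) \<le> exp (\<eta> * E N)"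
    for i :: "nat \<Rightarrow> nat" and E
    unfolding filterlim_at_top
  proof
    fix Z
    obtain n where n: "i n > nat \<lceil>exp (\<eta> * Z)\<rceil>"
      using no_bound by (meson not_le)
    have "Z \<le> E N" if "N \<ge> n" for N
    proof -
      have "exp (\<eta> * Z) \<le> real (i n)"
        using n by linarith
      also have "\<dots> \<le> real (i N)"
        using monoD[OF \<open>mono i\<close> that] by simp
      finally have "exp (\<eta> * Z) \<le> exp (\<eta> * E N)"
        using E[of N] by linarith
      then show ?thesis
        using \<open>\<eta> > 0\<close> by simp
    qed
    then show "\<forall>\<^sub>F N in sequentially. Z \<le> E N"
      unfolding eventually_sequentially by blast
  qed
  show ?thesis
  proof (cases "(\<exists>C. \<forall>N. j N \<le> C) \<and> (\<exists>C. \<forall>N. k N \<le> C)")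
    case False
    then show ?thesis
      using unbounded mono E1 E2 by blast
  next
    case True
    then obtain C C' where "\<And>N. j N \<le> C" "\<And>N. k N \<le> C'"
      by blast
    \<comment> \<open>The trivial premise gives the bound the shape that
      \<open>ex_has_greatest_nat\<close> expects. At the resulting index \<open>n\<close> the sum of
      the counters is maximal.\<close>
    then have "\<forall>N. True \<longrightarrow> j N + k N < Suc (C + C')"
      by (simp add: add_mono less_Suc_eq_le)
    from ex_has_greatest_nat[OF TrueI this] obtain n where n: "\<And>N. j N + k N \<le> j n + k n"
      by blast
    \<comment> \<open>\<open>B\<close> is the value of \<open>D\<close> at which the test with the
      final counters, \<open>2 ^ Suc (j n + k n) \<le> exp (\<eta> * D)\<close>, starts to
      succeed.\<close>
    define B where "B = ln (2 ^ Suc (j n + k n)) / \<eta>"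
    have no_step: "D1 (Suc N) < B \<and> D2 (Suc N) < B" if "N \<ge> n" for N
    proof -
      \<comment> \<open>Both counters are monotone and their sum cannot exceed its value at
        \<open>n\<close>, so each is constant from there on. A successful test would raise the sum
        above its maximum.\<close>
      have "j N = j n" "k N = k n"
        using n[of N] monoD[OF mono(1) that] monoD[OF mono(2) that] by linarith+
      then have "exp (\<eta> * D1 (Suc N)) < 2 ^ Suc (j n + k n)"
          "exp (\<eta> * D2 (Suc N)) < 2 ^ Suc (j n + k n)"
        using step[of N] n[of "Suc N"] by (simp_all del: power_Suc split: if_splits)
      then have "ln (exp (\<eta> * D1 (Suc N))) < ln (2 ^ Suc (j n + k n))"
          "ln (exp (\<eta> * D2 (Suc N))) < ln (2 ^ Suc (j n + k n))"
        by (simp_all only: ln_less_cancel_iff exp_gt_zero zero_less_numeral zero_less_power)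
      then show ?thesis
        using \<open>\<eta> > 0\<close> by (simp add: B_def pos_less_divide_eq mult.commute[of _ \<eta>] del: power_Suc)
    qed
    have "\<forall>\<^sub>F N in sequentially. d N < \<epsilon>" if "\<epsilon> > 0" for \<epsilon>
    proof -
      \<comment> \<open>Beyond the threshold \<open>max (1 / \<epsilon>) B\<close> the maximum
        cannot come from \<open>D1\<close> or \<open>D2\<close>, which are eventually below
        \<open>B\<close>; hence it comes from \<open>1 / d\<close>.\<close>
      have "\<forall>\<^sub>F N in sequentially. ereal (max (1 / \<epsilon>) B)
          < max (1 / ereal (d N)) (max (ereal (D1 N)) (ereal (D2 N)))"
        using lim unfolding tendsto_PInfty by blast
      moreover have "\<forall>\<^sub>F N in sequentially. D1 N < B \<and> D2 N < B"
        using eventually_sequentiallyI[of n "\<lambda>N. D1 (Suc N) < B \<and> D2 (Suc N) < B", OF no_step]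
        by (simp only: eventually_sequentially_Suc[of "\<lambda>N. D1 N < B \<and> D2 N < B"])
      ultimately show ?thesis
      proof eventually_elim
        case (elim N)
        then have "ereal (1 / \<epsilon>) < 1 / ereal (d N)"
          by (auto simp: less_max_iff_disj)
        then show "d N < \<epsilon>"
          \<comment> \<open>If \<open>d N = 0\<close>, the quotient is infinite and the claim is
            just \<open>\<epsilon> > 0\<close>.\<close>
          using that d[of N] by (cases "d N = 0") (simp_all add: one_ereal_def field_simps)
      qed
    qed
    then have "d \<longlonglongrightarrow> 0"
      using d by (simp add: tendsto_iff)
    then show ?thesis ..
  qed
qed

(* Division is that of ereal, where 1 / 0 = \<infinity>. *)
theorem proposition5:
  fixes \<Omega> :: "'w set" and \<Gamma> :: "'a::euclidean_space set" and loss :: "'w \<Rightarrow> 'a \<Rightarrow> real"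
  assumes "perfectly_mixable \<Omega> \<Gamma> loss"
    and "\<exists>\<sigma>. sceptic_strategy \<Omega> \<Gamma> \<sigma> \<and>
      guarantees \<Omega> \<Gamma> \<sigma> (\<lambda>\<gamma>1 \<gamma>2 \<gamma>s \<omega>.
        (\<lambda>N. max (1 / ereal (norm (\<gamma>1 N - \<gamma>2 N)))
              (max (ereal (cumulative_loss loss \<omega> \<gamma>1 N - cumulative_loss loss \<omega> \<gamma>s N))
                   (ereal (cumulative_loss loss \<omega> \<gamma>2 N - cumulative_loss loss \<omega> \<gamma>s N))))
          \<longlonglongrightarrow> \<infinity>)"
  shows "\<exists>\<sigma>. sceptic_strategy \<Omega> \<Gamma> \<sigma> \<and>
      guarantees \<Omega> \<Gamma> \<sigma> (\<lambda>\<gamma>1 \<gamma>2 \<gamma>s \<omega>.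
        (\<lambda>N. norm (\<gamma>1 N - \<gamma>2 N)) \<longlonglongrightarrow> 0 \<or>
        filterlim (\<lambda>N. cumulative_loss loss \<omega> \<gamma>1 N - cumulative_loss loss \<omega> \<gamma>s N)
          at_top sequentially \<or>
        filterlim (\<lambda>N. cumulative_loss loss \<omega> \<gamma>2 N - cumulative_loss loss \<omega> \<gamma>s N)
          at_top sequentially) \<and>
      guarantees \<Omega> \<Gamma> \<sigma> (\<lambda>\<gamma>1 \<gamma>2 \<gamma>s \<omega>.
        (\<lambda>N. norm (\<gamma>1 N - \<gamma>2 N)) \<longlonglongrightarrow> 0 \<or>
        filterlim (\<lambda>N. max (cumulative_loss loss \<omega> \<gamma>1 N - cumulative_loss loss \<omega> \<gamma>s N)
                           (cumulative_loss loss \<omega> \<gamma>2 N - cumulative_loss loss \<omega> \<gamma>s N))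
          at_top sequentially)"
proof -
  obtain \<eta> where \<eta>: "\<eta> > 0" and convex: "convex_functions \<Omega> (exp_superpredictions \<Omega> \<Gamma> loss \<eta>)"
    using assms(1) by (auto simp: perfectly_mixable_def)
  obtain \<sigma> where \<sigma>: "sceptic_strategy \<Omega> \<Gamma> \<sigma>" and guarantee: "guarantees \<Omega> \<Gamma> \<sigma> (\<lambda>\<gamma>1 \<gamma>2 \<gamma>s \<omega>.
        (\<lambda>N. max (1 / ereal (norm (\<gamma>1 N - \<gamma>2 N)))
              (max (ereal (cumulative_loss loss \<omega> \<gamma>1 N - cumulative_loss loss \<omega> \<gamma>s N))
                   (ereal (cumulative_loss loss \<omega> \<gamma>2 N - cumulative_loss loss \<omega> \<gamma>s N))))
          \<longlonglongrightarrow> \<infinity>)"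
    using assms(2) by blast
  let ?\<tau> = "mixing_strategy \<Omega> \<Gamma> \<eta> loss \<sigma>"
  note mixes = mixing_strategy_mixes[OF convex \<eta> \<sigma>]
  have \<tau>: "sceptic_strategy \<Omega> \<Gamma> ?\<tau>"
    unfolding sceptic_strategy_def by (intro ballI mixes_in_predictions[OF mixes])
  have main: "(\<lambda>N. norm (\<gamma>1 N - \<gamma>2 N)) \<longlonglongrightarrow> 0 \<or>
        filterlim (\<lambda>N. cumulative_loss loss \<omega> \<gamma>1 N - cumulative_loss loss \<omega> \<gamma>s N)
          at_top sequentially \<or>
        filterlim (\<lambda>N. cumulative_loss loss \<omega> \<gamma>2 N - cumulative_loss loss \<omega> \<gamma>s N)
          at_top sequentially"
    if "\<forall>n\<ge>1. \<gamma>1 n \<in> \<Gamma> \<and> \<gamma>2 n \<in> \<Gamma> \<and> \<omega> n \<in> \<Omega>"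
      and follows: "follows ?\<tau> \<gamma>1 \<gamma>2 \<gamma>s \<omega>" for \<gamma>1 \<gamma>2 \<gamma>s \<omega>
  proof -
    note moves = that(1)[rule_format]
    let ?st = "\<lambda>n. state \<eta> loss \<sigma> (history \<gamma>1 \<gamma>2 \<gamma>s \<omega> n)"
    \<comment> \<open>The Sceptic of a fictitious play: the Predictors and Nature move as in the
      actual play, but \<open>\<sigma>\<close> answers them on its own simulated history.\<close>
    define \<gamma>\<sigma> where "\<gamma>\<sigma> n = \<sigma> (fst (?st n)) (\<gamma>1 n) (\<gamma>2 n)" for n
    \<comment> \<open>The counters after \<open>N\<close> rounds, hence the state at index
      \<open>Suc N\<close>.\<close>
    define j where "j N = fst (snd (?st (Suc N)))" for N
    define k where "k N = snd (snd (?st (Suc N)))" for N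
    define D1 where "D1 N = cumulative_loss loss \<omega> \<gamma>1 N - cumulative_loss loss \<omega> \<gamma>\<sigma> N" for N
    define D2 where "D2 N = cumulative_loss loss \<omega> \<gamma>2 N - cumulative_loss loss \<omega> \<gamma>\<sigma> N" for N
    define E1 where "E1 N = cumulative_loss loss \<omega> \<gamma>1 N - cumulative_loss loss \<omega> \<gamma>s N" for N
    define E2 where "E2 N = cumulative_loss loss \<omega> \<gamma>2 N - cumulative_loss loss \<omega> \<gamma>s N" for N
    have init: "?st (Suc 0) = ([], 0, 0)"
      by (simp add: history_1 state_def)
    have st_Suc: "?st (Suc (Suc N)) = update_state \<eta> loss \<sigma> (?st (Suc N))
        (\<gamma>1 (Suc N), \<gamma>2 (Suc N), \<gamma>s (Suc N), \<omega> (Suc N))" for N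
      by (simp add: history_Suc state_def)
    have fst_st: "fst (?st (Suc N)) = history \<gamma>1 \<gamma>2 \<gamma>\<sigma> \<omega> (Suc N)" for N
    proof (induction N)
      case 0
      then show ?case by (simp add: state_def history_1)
    next
      case (Suc N)
      have "fst (?st (Suc (Suc N))) = fst (?st (Suc N)) @
          [(\<gamma>1 (Suc N), \<gamma>2 (Suc N), \<gamma>\<sigma> (Suc N), \<omega> (Suc N))]"
        unfolding st_Suc \<gamma>\<sigma>_def by (cases "?st (Suc N)") (simp add: Let_def)
      then show ?case
        by (simp add: Suc.IH history_Suc[of "Suc N"])
    qed
    have st: "?st (Suc N) = (history \<gamma>1 \<gamma>2 \<gamma>\<sigma> \<omega> (Suc N), j N, k N)" for N
      by (simp add: prod_eq_iff fst_st j_def k_def)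
    have \<gamma>\<sigma>: "\<gamma>\<sigma> (Suc N) = \<sigma> (history \<gamma>1 \<gamma>2 \<gamma>\<sigma> \<omega> (Suc N)) (\<gamma>1 (Suc N)) (\<gamma>2 (Suc N))" for N
      by (simp add: \<gamma>\<sigma>_def[of "Suc N"] fst_st)
    \<comment> \<open>The fictitious play is a genuine play of \<open>\<sigma>\<close>, so the
      hypothesis applies to the advantages \<open>D1\<close> and \<open>D2\<close> measured in
      it.\<close>
    have "follows \<sigma> \<gamma>1 \<gamma>2 \<gamma>\<sigma> \<omega>"
      unfolding follows_def
    proof (intro allI impI)
      fix n :: nat
      assume "n \<ge> 1"
      then obtain N where "n = Suc N"
        by (cases n) auto
      then show "\<gamma>\<sigma> n = \<sigma> (history \<gamma>1 \<gamma>2 \<gamma>\<sigma> \<omega> n) (\<gamma>1 n) (\<gamma>2 n)"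
        using \<gamma>\<sigma> by blast
    qed
    then have lim: "(\<lambda>N. max (1 / ereal (norm (\<gamma>1 N - \<gamma>2 N))) (max (ereal (D1 N)) (ereal (D2 N))))
        \<longlonglongrightarrow> \<infinity>"
      using guarantee moves unfolding guarantees_def D1_def D2_def by blast
    have step: "(j (Suc N), k (Suc N)) =
        (if 2 ^ Suc (j N + k N) \<le> exp (\<eta> * D1 (Suc N)) then (Suc (j N), k N)
         else if 2 ^ Suc (j N + k N) \<le> exp (\<eta> * D2 (Suc N)) then (j N, Suc (k N))
         else (j N, k N))" for N
    proof -
      have "history \<gamma>1 \<gamma>2 \<gamma>\<sigma> \<omega> (Suc N) @ [(\<gamma>1 (Suc N), \<gamma>2 (Suc N), \<gamma>\<sigma> (Suc N), \<omega> (Suc N))]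
          = history \<gamma>1 \<gamma>2 \<gamma>\<sigma> \<omega> (Suc (Suc N))"
        by (simp add: history_Suc[of "Suc N"])
      then have "(history \<gamma>1 \<gamma>2 \<gamma>\<sigma> \<omega> (Suc (Suc N)), j (Suc N), k (Suc N)) =
          (let h = history \<gamma>1 \<gamma>2 \<gamma>\<sigma> \<omega> (Suc (Suc N)) in
            if 2 ^ Suc (j N + k N) \<le> exp (\<eta> * D1 (Suc N)) then (h, Suc (j N), k N)
            else if 2 ^ Suc (j N + k N) \<le> exp (\<eta> * D2 (Suc N)) then (h, j N, Suc (k N))
            else (h, j N, k N))"
        using st_Suc[of N]
        by (simp only: st update_state.simps Let_def \<gamma>\<sigma>[symmetric] advantage_history
            D1_def[symmetric] D2_def[symmetric])
      then show ?thesis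
        by (simp only: Let_def prod.inject split: if_splits) simp_all
    qed
    have in_\<Gamma>: "\<gamma>s n \<in> \<Gamma>" if "n \<ge> 1" for n
      using follows_in_predictions[OF \<tau> follows moves that] .
    let ?S = "\<lambda>N. cumulative_loss loss \<omega> \<gamma>s N - cumulative_loss loss \<omega> \<gamma>\<sigma> N"
    \<comment> \<open>This is the invariant after multiplication by exp (\<eta> * \<Lambda>), which
      leaves only differences of losses. It starts as 1 \<le> 1.\<close>
    have invariant: "1 / 2 ^ (j N + k N) + j N * exp (- \<eta> * D1 N) + k N * exp (- \<eta> * D2 N)
        \<le> exp (- \<eta> * ?S N)" for N
    proof (induction N)
      case 0
      then show ?case
        by (simp add: cumulative_loss_def j_def k_def init)
    next
      case (Suc N)
      let ?n = "Suc N"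
      let ?l = "\<lambda>\<gamma>. loss (\<omega> ?n) (\<gamma> ?n)"
      let ?a = "1 / 2 ^ (j N + k N) :: real"
      let ?b = "j N * exp (- \<eta> * D1 N)" and ?c = "k N * exp (- \<eta> * D2 N)"
      have "history \<gamma>1 \<gamma>2 \<gamma>s \<omega> ?n \<in> lists (\<Gamma> \<times> \<Gamma> \<times> \<Gamma> \<times> \<Omega>)"
        by (rule history_in_lists) (use moves in_\<Gamma> in auto)
      then have "mixes \<Omega> \<Gamma> \<eta> loss \<sigma> (?st ?n) (\<gamma>1 ?n) (\<gamma>2 ?n) (\<gamma>s ?n)"
        using mixes moves[of ?n] follows by (simp add: follows_def)
      then have "?a * exp (- \<eta> * ?l \<gamma>\<sigma>) + ?b * exp (- \<eta> * ?l \<gamma>1) + ?c * exp (- \<eta> * ?l \<gamma>2)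
          \<le> (?a + ?b + ?c) * exp (- \<eta> * ?l \<gamma>s)"
        using moves[of ?n]
        by (simp only: mixes_def st Let_def prod.case \<gamma>\<sigma>[symmetric] advantage_history
            D1_def[symmetric] D2_def[symmetric])
      also have "\<dots> \<le> exp (- \<eta> * ?S N) * exp (- \<eta> * ?l \<gamma>s)"
        using Suc.IH by (intro mult_right_mono) simp_all
      \<comment> \<open>Multiplying by \<open>exp (\<eta> * ?l \<gamma>\<sigma>)\<close>
        renormalizes by the loss of \<open>\<sigma>\<close> in this round. The result,
        \<open>weights\<close>, has the new advantages but still the old counters.\<close>
      finally have "(?a * exp (- \<eta> * ?l \<gamma>\<sigma>) + ?b * exp (- \<eta> * ?l \<gamma>1) + ?c * exp (- \<eta> * ?l \<gamma>2))
          * exp (\<eta> * ?l \<gamma>\<sigma>) \<le> (exp (- \<eta> * ?S N) * exp (- \<eta> * ?l \<gamma>s)) * exp (\<eta> * ?l \<gamma>\<sigma>)"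
        by (rule mult_right_mono) simp
      moreover have "exp (- \<eta> * ?l \<gamma>\<sigma>) * exp (\<eta> * ?l \<gamma>\<sigma>) = 1"
          "exp (- \<eta> * D1 N) * (exp (- \<eta> * ?l \<gamma>1) * exp (\<eta> * ?l \<gamma>\<sigma>)) = exp (- \<eta> * D1 ?n)"
          "exp (- \<eta> * D2 N) * (exp (- \<eta> * ?l \<gamma>2) * exp (\<eta> * ?l \<gamma>\<sigma>)) = exp (- \<eta> * D2 ?n)"
          "exp (- \<eta> * ?S N) * (exp (- \<eta> * ?l \<gamma>s) * exp (\<eta> * ?l \<gamma>\<sigma>)) = exp (- \<eta> * ?S ?n)"
        unfolding mult_exp_exp by (simp_all add: cumulative_loss_def D1_def D2_def algebra_simps)
      ultimately have weights: "?a + j N * exp (- \<eta> * D1 ?n) + k N * exp (- \<eta> * D2 ?n)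
          \<le> exp (- \<eta> * ?S ?n)"
        by (simp only: distrib_right mult.assoc mult_1_right)
      \<comment> \<open>One half of \<open>?a\<close> remains as the new first summand; the other
        half covers the additional \<open>exp (- \<eta> * D)\<close>. Since at most one counter
        grows per round, this half is spent at most once.\<close>
      have split: "?a \<ge> 1 / 2 ^ Suc (j N + k N) + exp (- \<eta> * D)"
        if "2 ^ Suc (j N + k N) \<le> exp (\<eta> * D)" for D
      proof -
        have "exp (- \<eta> * D) = 1 / exp (\<eta> * D)"
          by (simp add: exp_minus inverse_eq_divide)
        also have "\<dots> \<le> 1 / 2 ^ Suc (j N + k N)"
          by (rule frac_le) (use that in simp_all)
        finally show ?thesis by simp
      qed
      show ?case
      proof -
        consider (j) "2 ^ Suc (j N + k N) \<le> exp (\<eta> * D1 ?n)" "j ?n = Suc (j N)" "k ?n = k N"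
          | (k) "2 ^ Suc (j N + k N) \<le> exp (\<eta> * D2 ?n)" "j ?n = j N" "k ?n = Suc (k N)"
          | (none) "j ?n = j N" "k ?n = k N"
          using step[of N] by (simp only: prod.inject split: if_splits)
        then show ?thesis
        proof cases
          case j
          then show ?thesis
            using weights split[OF j(1)] by (simp add: distrib_right)
        next
          case k
          then show ?thesis
            using weights split[OF k(1)] by (simp add: distrib_right)
        next
          case none
          then show ?thesis
            using weights by simp
        qed
      qed
    qed
    have bounds: "j N * exp (- \<eta> * D1 N) \<le> exp (- \<eta> * ?S N)"
        "k N * exp (- \<eta> * D2 N) \<le> exp (- \<eta> * ?S N)" for N
    proof -
      have "0 \<le> 1 / (2::real) ^ (j N + k N)" "0 \<le> j N * exp (- \<eta> * D1 N)" "0 \<le> k N * exp (- \<eta> * D2 N)"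
        by simp_all
      with invariant[of N] show "j N * exp (- \<eta> * D1 N) \<le> exp (- \<eta> * ?S N)"
        "k N * exp (- \<eta> * D2 N) \<le> exp (- \<eta> * ?S N)" by linarith+
    qed
    \<comment> \<open>The losses of \<open>\<sigma>\<close> cancel:
      \<open>D1 N - ?S N = E1 N\<close>. The same computation serves the second Predictor.\<close>
    have E1: "real (j N) \<le> exp (\<eta> * E1 N)" for N
    proof -
      have "real (j N) = j N * exp (- \<eta> * D1 N) * exp (\<eta> * D1 N)"
        by (simp add: mult.assoc mult_exp_exp)
      also have "\<dots> \<le> exp (- \<eta> * ?S N) * exp (\<eta> * D1 N)"
        by (intro mult_right_mono bounds) simp
      also have "\<dots> = exp (\<eta> * E1 N)"
        unfolding mult_exp_exp by (simp add: D1_def E1_def algebra_simps)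
      finally show ?thesis .
    qed
    have E2: "real (k N) \<le> exp (\<eta> * E2 N)" for N
    proof -
      have "real (k N) = k N * exp (- \<eta> * D2 N) * exp (\<eta> * D2 N)"
        by (simp add: mult.assoc mult_exp_exp)
      also have "\<dots> \<le> exp (- \<eta> * ?S N) * exp (\<eta> * D2 N)"
        by (intro mult_right_mono bounds) simp
      also have "\<dots> = exp (\<eta> * E2 N)"
        unfolding mult_exp_exp by (simp add: D2_def E2_def algebra_simps)
      finally show ?thesis .
    qed
    show ?thesis
      using counters_dichotomy[OF \<eta> step E1 E2 norm_ge_zero lim]
      by (simp add: E1_def E2_def)
  qed
  have max: "filterlim (\<lambda>N. max (f N) (g N)) at_top sequentially"
    if "filterlim f at_top sequentially \<or> filterlim g at_top sequentially" for f g :: "nat \<Rightarrow> real"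
    using that
  proof
    assume "filterlim f at_top sequentially"
    then show ?thesis
      by (rule filterlim_at_top_mono) simp
  next
    assume "filterlim g at_top sequentially"
    then show ?thesis
      by (rule filterlim_at_top_mono) simp
  qed
  show ?thesis
    unfolding guarantees_def
  proof (intro exI[of _ ?\<tau>] conjI allI impI)
    fix \<gamma>1 \<gamma>2 \<gamma>s \<omega>
    assume "\<forall>n\<ge>1. \<gamma>1 n \<in> \<Gamma> \<and> \<gamma>2 n \<in> \<Gamma> \<and> \<omega> n \<in> \<Omega>" and "follows ?\<tau> \<gamma>1 \<gamma>2 \<gamma>s \<omega>"
    note alternatives = main[OF this]
    then show "(\<lambda>N. norm (\<gamma>1 N - \<gamma>2 N)) \<longlonglongrightarrow> 0 \<or>
        filterlim (\<lambda>N. cumulative_loss loss \<omega> \<gamma>1 N - cumulative_loss loss \<omega> \<gamma>s N)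
          at_top sequentially \<or>
        filterlim (\<lambda>N. cumulative_loss loss \<omega> \<gamma>2 N - cumulative_loss loss \<omega> \<gamma>s N)
          at_top sequentially" .
    from alternatives show "(\<lambda>N. norm (\<gamma>1 N - \<gamma>2 N)) \<longlonglongrightarrow> 0 \<or>
        filterlim (\<lambda>N. max (cumulative_loss loss \<omega> \<gamma>1 N - cumulative_loss loss \<omega> \<gamma>s N)
                           (cumulative_loss loss \<omega> \<gamma>2 N - cumulative_loss loss \<omega> \<gamma>s N))
          at_top sequentially"
      by (rule disj_forward) (assumption, rule max)
  qed (rule \<tau>)
qed

end
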